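(* Let $a$, $b$ and $\alpha$ be real numbers and let $(p,q,r,u)$ be given by $$p=0,\qquad q=\frac{e^{\,i\frac{b z\bar z}{2(a+bt)}}}{a+bt}\,\alpha\bar z,\qquad r=\frac{e^{-i\frac{b z\bar z}{2(a+bt)}}}{a+bt}\,\alpha\bar z,\qquad u=\frac{2\alpha^2z\bar z}{(a+bt)^2}.$$ Then $(p,q,r,u)$ is a solution to the system $$\begin{cases} iq_t+q_{z\bar z}-2uq+2(\bar p q)_z-2pq_{\bar z}-4|p|^2q=0,\\ ir_t-r_{z\bar z}+2ur+2(\bar p r)_z-2pr_{\bar z}+4|p|^2r=0,\\ ip_t+(qr)_{\bar z}-u_z=0,\\ \bar p_z+p_{\bar z}=-|q|^2+|r|^2,\\ -\bar r_z+q_{\bar z}=-2(p\bar r+\bar p q)\end{cases}$$ if and only if $\alpha^2=\frac{b^2}{16}$.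
   Context: Coordinates on $\mathbf{R}^2$ are $(x_1,x_2)$, $t$ is real time, and $z=\frac{x_1+ix_2}{2}$, $\bar z=\frac{x_1-ix_2}{2}$ (note the nonstandard factor $\frac12$), so that $\partial_z=\partial_{x_1}-i\partial_{x_2}$, $\partial_{\bar z}=\partial_{x_1}+i\partial_{x_2}$ and $\partial_z\partial_{\bar z}=\partial_{x_1}^2+\partial_{x_2}^2$. Subscripts denote partial derivatives, and $\bar p_z$, $\bar r_z$ mean $\partial_z(\bar p)$, $\partial_z(\bar r)$. The functions are considered where the formulas make sense, i.e. where $a+bt\neq0$. In the system, $p,q,r$ are unknown complex functions and $u$ is an unknown real function.
   Formalization: The formal statement assumes that α ≠ 0 or b = 0 (for α = 0, b ≠ 0 all functions vanish and solve the system although α² ≠ b²/16) and that a, b are not both 0 (otherwise a+bt vanishes identically and the formulas are undefined). *)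

theory Defs
  imports "HOL-Analysis.Analysis"
begin

(* A point (x1, x2, t) of space-time; the first two components are the coordinates of the plane. *)
type_synonym point = "real \<times> real \<times> real"

(* The nonstandard factor 1/2 goes with the absence of a factor 1/2 in Dz and Dzbar below:
   Dz z = Dzbar (cnj z) = 1, Dz (cnj z) = Dzbar z = 0, and Dz Dzbar is the Laplacian. *)
definition zc :: "point \<Rightarrow> complex" where
  "zc = (\<lambda>(x\<^sub>1, x\<^sub>2, t). (complex_of_real x\<^sub>1 + \<i> * complex_of_real x\<^sub>2) / 2)"

definition D1 :: "(point \<Rightarrow> complex) \<Rightarrow> point \<Rightarrow> complex" where
  "D1 f = (\<lambda>(x\<^sub>1, x\<^sub>2, t). vector_derivative (\<lambda>s. f (s, x\<^sub>2, t)) (at x\<^sub>1))"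

definition D2 :: "(point \<Rightarrow> complex) \<Rightarrow> point \<Rightarrow> complex" where
  "D2 f = (\<lambda>(x\<^sub>1, x\<^sub>2, t). vector_derivative (\<lambda>s. f (x\<^sub>1, s, t)) (at x\<^sub>2))"

definition Dt :: "(point \<Rightarrow> complex) \<Rightarrow> point \<Rightarrow> complex" where
  "Dt f = (\<lambda>(x\<^sub>1, x\<^sub>2, t). vector_derivative (\<lambda>s. f (x\<^sub>1, x\<^sub>2, s)) (at t))"

definition Dz :: "(point \<Rightarrow> complex) \<Rightarrow> point \<Rightarrow> complex" where
  "Dz f X = D1 f X - \<i> * D2 f X"

definition Dzbar :: "(point \<Rightarrow> complex) \<Rightarrow> point \<Rightarrow> complex" where
  "Dzbar f X = D1 f X + \<i> * D2 f X"

definition partials_exist :: "point set \<Rightarrow> (point \<Rightarrow> complex) \<Rightarrow> bool" where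
  "partials_exist \<Omega> f \<longleftrightarrow> (\<forall>(x\<^sub>1, x\<^sub>2, t)\<in>\<Omega>.
     (\<lambda>s. f (s, x\<^sub>2, t)) differentiable at x\<^sub>1 \<and>
     (\<lambda>s. f (x\<^sub>1, s, t)) differentiable at x\<^sub>2 \<and>
     (\<lambda>s. f (x\<^sub>1, x\<^sub>2, s)) differentiable at t)"

(* Functions of class C^k on an open set. *)
fun Ck_on :: "nat \<Rightarrow> point set \<Rightarrow> (point \<Rightarrow> complex) \<Rightarrow> bool" where
  "Ck_on 0 \<Omega> f \<longleftrightarrow> continuous_on \<Omega> f"
| "Ck_on (Suc k) \<Omega> f \<longleftrightarrow> continuous_on \<Omega> f \<and> partials_exist \<Omega> f \<and>
     Ck_on k \<Omega> (D1 f) \<and> Ck_on k \<Omega> (D2 f) \<and> Ck_on k \<Omega> (Dt f)"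

(* Classical solutions on an open set. The regularity requirement is needed because
   vector_derivative returns an unspecified value where the derivative does not exist. *)
definition is_solution ::
  "point set \<Rightarrow> (point \<Rightarrow> complex) \<Rightarrow> (point \<Rightarrow> complex) \<Rightarrow> (point \<Rightarrow> complex) \<Rightarrow>
   (point \<Rightarrow> real) \<Rightarrow> bool" where
  "is_solution \<Omega> p q r u \<longleftrightarrow>
     Ck_on 2 \<Omega> p \<and> Ck_on 2 \<Omega> q \<and> Ck_on 2 \<Omega> r \<and> Ck_on 2 \<Omega> (\<lambda>X. complex_of_real (u X)) \<and>
     (\<forall>X\<in>\<Omega>.
        \<i> * Dt q X + Dzbar (Dz q) X - 2 * complex_of_real (u X) * q X
          + 2 * Dz (\<lambda>Y. cnj (p Y) * q Y) X - 2 * p X * Dzbar q X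
          - 4 * complex_of_real ((cmod (p X))\<^sup>2) * q X = 0 \<and>
        \<i> * Dt r X - Dzbar (Dz r) X + 2 * complex_of_real (u X) * r X
          + 2 * Dz (\<lambda>Y. cnj (p Y) * r Y) X - 2 * p X * Dzbar r X
          + 4 * complex_of_real ((cmod (p X))\<^sup>2) * r X = 0 \<and>
        \<i> * Dt p X + Dzbar (\<lambda>Y. q Y * r Y) X - Dz (\<lambda>Y. complex_of_real (u Y)) X = 0 \<and>
        Dz (\<lambda>Y. cnj (p Y)) X + Dzbar p X
          = - complex_of_real ((cmod (q X))\<^sup>2) + complex_of_real ((cmod (r X))\<^sup>2) \<and>
        - Dz (\<lambda>Y. cnj (r Y)) X + Dzbar q X
          = - 2 * (p X * cnj (r X) + cnj (p X) * q X))"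

end

theory Submission imports Defs begin

text \<open>Put \<open>T = a + b t\<close> and \<open>E = exp (i b |z|\<^sup>2 / (2 T))\<close>. In \<open>i q\<^sub>t + \<Delta> q\<close> all terms of order
  \<open>1 / T\<^sup>2\<close> cancel, and the first equation reduces to
  \<open>\<alpha> E |z|\<^sup>2 (cnj z) (b\<^sup>2 / 4 - 4 \<alpha>\<^sup>2) / T\<^sup>3 = 0\<close>. The second one reduces to the same condition with
  \<open>E\<close> replaced by its inverse; the other three equations hold for every \<open>\<alpha>\<close>.\<close>

section \<open>Calculus of first partial derivatives\<close>

text \<open>A relation carries existence and value together, so differentiation rules compose
  without the separate differentiability conditions that \<open>D1\<close>, \<open>D2\<close> and
  \<open>Dt\<close> would require.\<close>

definition has_partials :: "(point \<Rightarrow> complex) \<Rightarrow> complex \<Rightarrow> complex \<Rightarrow> complex \<Rightarrow> point \<Rightarrow> bool" where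
  "has_partials f f1 f2 f3 = (\<lambda>(x, y, t).
     ((\<lambda>s. f (s, y, t)) has_vector_derivative f1) (at x) \<and>
     ((\<lambda>s. f (x, s, t)) has_vector_derivative f2) (at y) \<and>
     ((\<lambda>s. f (x, y, s)) has_vector_derivative f3) (at t))"

lemma has_partials_D:
  assumes "has_partials f f1 f2 f3 X"
  shows "D1 f X = f1" "D2 f X = f2" "Dt f X = f3"
  using assms by (cases X; simp add: has_partials_def D1_def D2_def Dt_def vector_derivative_at)+

lemma has_partials_Dz:
  assumes "has_partials f f1 f2 f3 X"
  shows "Dz f X = f1 - \<i> * f2" "Dzbar f X = f1 + \<i> * f2"
  using has_partials_D[OF assms] by (simp_all add: Dz_def Dzbar_def)

lemma partials_exist_iff:
  "partials_exist \<Omega> f \<longleftrightarrow> (\<forall>X\<in>\<Omega>. has_partials f (D1 f X) (D2 f X) (Dt f X) X)"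
  by (auto simp: partials_exist_def has_partials_def D1_def D2_def Dt_def vector_derivative_works
      split: prod.splits)

lemma has_partials_eq:
  "\<lbrakk>has_partials f f1 f2 f3 X; f1 = g1; f2 = g2; f3 = g3\<rbrakk> \<Longrightarrow> has_partials f g1 g2 g3 X"
  by simp

lemma has_partials_const: "has_partials (\<lambda>X. c) 0 0 0 X"
  by (cases X) (simp add: has_partials_def)

lemma has_partials_add:
  assumes "has_partials f f1 f2 f3 X" "has_partials g g1 g2 g3 X"
  shows "has_partials (\<lambda>X. f X + g X) (f1 + g1) (f2 + g2) (f3 + g3) X"
  using assms by (cases X) (auto simp: has_partials_def intro!: has_vector_derivative_add)

lemma has_partials_mult:
  assumes "has_partials f f1 f2 f3 X" "has_partials g g1 g2 g3 X"
  shows "has_partials (\<lambda>X. f X * g X) (f X * g1 + f1 * g X) (f X * g2 + f2 * g X)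
    (f X * g3 + f3 * g X) X"
  using assms by (cases X) (auto simp: has_partials_def intro!: has_vector_derivative_mult)

lemma has_partials_chain:
  assumes "has_partials f f1 f2 f3 X" "(\<phi> has_field_derivative d) (at (f X))"
  shows "has_partials (\<lambda>X. \<phi> (f X)) (f1 * d) (f2 * d) (f3 * d) X"
  using assms field_vector_diff_chain_at[unfolded o_def]
  by (cases X) (fastforce simp: has_partials_def)

lemma has_partials_exp:
  assumes "has_partials f f1 f2 f3 X"
  shows "has_partials (\<lambda>X. exp (f X)) (f1 * exp (f X)) (f2 * exp (f X)) (f3 * exp (f X)) X"
  by (rule has_partials_chain[OF assms DERIV_exp])

lemma has_partials_inverse:
  assumes "has_partials f f1 f2 f3 X" "f X \<noteq> 0"
  shows "has_partials (\<lambda>X. inverse (f X)) (f1 * - (inverse (f X) * inverse (f X)))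
    (f2 * - (inverse (f X) * inverse (f X))) (f3 * - (inverse (f X) * inverse (f X))) X"
  by (rule has_partials_chain[OF assms(1)], rule DERIV_cong[OF DERIV_inverse[OF assms(2)]])
    (simp add: numeral_2_eq_2)

text \<open>Partial derivatives are local: the coordinate lines through \<open>X\<close> meet the
  open set \<open>\<Omega>\<close> in relatively open sets, on which \<open>f\<close> and
  \<open>g\<close> agree. This handles functions prescribed only on \<open>\<Omega>\<close>.\<close>

lemma has_partials_transform:
  assumes f: "has_partials f f1 f2 f3 X" and "open \<Omega>" "X \<in> \<Omega>"
    and eq: "\<And>Y. Y \<in> \<Omega> \<Longrightarrow> f Y = g Y"
  shows "has_partials g f1 f2 f3 X"
proof -
  obtain x y t where X: "X = (x, y, t)" by (cases X)
  have "open ((\<lambda>s. (s, y, t)) -` \<Omega>)" "open ((\<lambda>s. (x, s, t)) -` \<Omega>)" "open ((\<lambda>s. (x, y, s)) -` \<Omega>)"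
    using \<open>open \<Omega>\<close> by (intro open_vimage continuous_intros; simp)+
  note slices = this
  have f': "((\<lambda>s. f (s, y, t)) has_vector_derivative f1) (at x)"
    "((\<lambda>s. f (x, s, t)) has_vector_derivative f2) (at y)"
    "((\<lambda>s. f (x, y, s)) has_vector_derivative f3) (at t)"
    using f by (simp_all add: X has_partials_def)
  note transform = has_vector_derivative_transform_within_open
  show ?thesis
    using \<open>X \<in> \<Omega>\<close> eq unfolding X has_partials_def prod.case
    by (intro conjI transform[OF f'(1) slices(1)] transform[OF f'(2) slices(2)]
        transform[OF f'(3) slices(3)]) simp_all
qed

section \<open>Closure properties of the classes C^k\<close>

text \<open>On an open set the derivatives of \<open>f\<close> and \<open>g\<close> agree as well,
  so the induction passes to them.\<close>

lemma Ck_on_cong: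
  assumes "open \<Omega>" "Ck_on k \<Omega> f" "\<And>X. X \<in> \<Omega> \<Longrightarrow> f X = g X"
  shows "Ck_on k \<Omega> g"
  using assms(2,3)
proof (induction k arbitrary: f g)
  case 0
  then show ?case unfolding Ck_on.simps by (rule continuous_on_eq)
next
  case (Suc k)
  have g: "has_partials g (D1 f X) (D2 f X) (Dt f X) X" if "X \<in> \<Omega>" for X
    by (rule has_partials_transform[OF _ \<open>open \<Omega>\<close> that, of f])
      (use Suc.prems that in \<open>simp_all add: partials_exist_iff\<close>)
  have "continuous_on \<Omega> g"
    using Suc.prems unfolding Ck_on.simps by (blast intro: continuous_on_eq)
  moreover have "Ck_on k \<Omega> (D1 g)" "Ck_on k \<Omega> (D2 g)" "Ck_on k \<Omega> (Dt g)"
    by (rule Suc.IH; use Suc.prems(1) has_partials_D[OF g] in simp)+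
  ultimately show ?case
    using g by (simp add: partials_exist_iff has_partials_D[OF g])
qed

text \<open>Reduces regularity of \<open>f\<close> to that of explicit formulas for its derivatives,
  in place of \<open>D1 f\<close>, \<open>D2 f\<close> and \<open>Dt f\<close>.\<close>

lemma Ck_on_SucI:
  assumes "open \<Omega>" "continuous_on \<Omega> f"
    and f: "\<And>X. X \<in> \<Omega> \<Longrightarrow> has_partials f (f1 X) (f2 X) (f3 X) X"
    and "Ck_on k \<Omega> f1" "Ck_on k \<Omega> f2" "Ck_on k \<Omega> f3"
  shows "Ck_on (Suc k) \<Omega> f"
proof -
  note cong = Ck_on_cong[OF \<open>open \<Omega>\<close>]
  have "Ck_on k \<Omega> (D1 f)" "Ck_on k \<Omega> (D2 f)" "Ck_on k \<Omega> (Dt f)"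
    using cong[OF assms(4), of "D1 f"] cong[OF assms(5), of "D2 f"] cong[OF assms(6), of "Dt f"]
    by (simp_all add: has_partials_D[OF f])
  then show ?thesis
    using assms(2) f by (simp add: partials_exist_iff has_partials_D[OF f])
qed

text \<open>The inclusion of C^(k+1) in C^k takes an induction, because the recursion lowers the
  order only by differentiating. The product, exponential and inverse rules rely on it, since their
  derivatives contain \<open>f\<close> itself.\<close>

lemma Ck_on_SucD:
  assumes "Ck_on (Suc k) \<Omega> f"
  shows "Ck_on k \<Omega> f" "Ck_on k \<Omega> (D1 f)" "Ck_on k \<Omega> (D2 f)" "Ck_on k \<Omega> (Dt f)"
    "continuous_on \<Omega> f" "X \<in> \<Omega> \<Longrightarrow> has_partials f (D1 f X) (D2 f X) (Dt f X) X"
proof -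
  show "Ck_on k \<Omega> f"
    using assms
  proof (induction k arbitrary: f)
    case (Suc k)
    then show ?case
      by (subst Ck_on.simps(2)) (use Suc.IH in \<open>simp (no_asm_use); blast\<close>)
  qed simp
qed (use assms in \<open>auto simp: partials_exist_iff\<close>)

lemma Ck_on_const: "open \<Omega> \<Longrightarrow> Ck_on k \<Omega> (\<lambda>X. c)"
proof (induction k arbitrary: c)
  case (Suc k)
  then show ?case
    by (intro Ck_on_SucI[OF _ _ has_partials_const]) auto
qed simp

lemma Ck_on_add:
  assumes "open \<Omega>" "Ck_on k \<Omega> f" "Ck_on k \<Omega> g"
  shows "Ck_on k \<Omega> (\<lambda>X. f X + g X)"
  using assms(2,3)
proof (induction k arbitrary: f g)
  case (Suc k)
  note f = Ck_on_SucD[OF Suc.prems(1)] and g = Ck_on_SucD[OF Suc.prems(2)]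
  show ?case
    by (intro Ck_on_SucI[OF assms(1) _ has_partials_add[OF f(6) g(6)]] continuous_on_add
        Suc.IH f(1-5) g(1-5))
qed (simp add: continuous_on_add)

lemma Ck_on_mult:
  assumes "open \<Omega>" "Ck_on k \<Omega> f" "Ck_on k \<Omega> g"
  shows "Ck_on k \<Omega> (\<lambda>X. f X * g X)"
  using assms(2,3)
proof (induction k arbitrary: f g)
  case (Suc k)
  note f = Ck_on_SucD[OF Suc.prems(1)] and g = Ck_on_SucD[OF Suc.prems(2)]
  show ?case
    by (intro Ck_on_SucI[OF assms(1) _ has_partials_mult[OF f(6) g(6)]] continuous_on_mult Ck_on_add
        assms(1) Suc.IH f(1-5) g(1-5))
qed (simp add: continuous_on_mult)

text \<open>The derivatives contain \<open>exp (f X)\<close> again, but only at order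
  \<open>k\<close>, where the induction hypothesis covers it.\<close>

lemma Ck_on_exp:
  assumes "open \<Omega>" "Ck_on k \<Omega> f"
  shows "Ck_on k \<Omega> (\<lambda>X. exp (f X))"
  using assms(2)
proof (induction k)
  case (Suc k)
  note f = Ck_on_SucD[OF Suc.prems]
  show ?case
    by (intro Ck_on_SucI[OF assms(1) _ has_partials_exp[OF f(6)]] continuous_on_exp Ck_on_mult
        assms(1) Suc.IH f(1-5))
qed (simp add: continuous_on_exp)

lemma Ck_on_inverse:
  assumes "open \<Omega>" "Ck_on k \<Omega> f" and nz: "\<And>X. X \<in> \<Omega> \<Longrightarrow> f X \<noteq> 0"
  shows "Ck_on k \<Omega> (\<lambda>X. inverse (f X))"
  using assms(2)
proof (induction k)
  case 0
  then show ?case using nz by (simp add: continuous_on_inverse)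
next
  case (Suc k)
  note f = Ck_on_SucD[OF Suc.prems]
  \<comment> \<open>Negation is written as multiplication by a constant, so that
    \<open>Ck_on_mult\<close> applies.\<close>
  have "Ck_on k \<Omega> (\<lambda>X. - 1 * (inverse (f X) * inverse (f X)))"
    by (intro Ck_on_mult Ck_on_const assms(1) Suc.IH f(1-5))
  then have "Ck_on k \<Omega> (\<lambda>X. - (inverse (f X) * inverse (f X)))" by simp
  note I = this
  show ?case
    by (intro Ck_on_SucI[OF assms(1) _ has_partials_inverse[OF f(6) nz]] continuous_on_inverse Ck_on_mult
        assms(1) ballI nz f(1-5) I)
qed

section \<open>Coordinate functions and the wave profile\<close>

definition tc :: "real \<Rightarrow> real \<Rightarrow> point \<Rightarrow> complex" where
  "tc a b = (\<lambda>(x, y, t). complex_of_real (a + b * t))"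

lemma has_partials_zc: "has_partials zc (1 / 2) (\<i> / 2) 0 X"
  by (cases X) (auto simp: has_partials_def zc_def intro!: derivative_eq_intros)

lemma has_partials_cnj_zc: "has_partials (\<lambda>X. cnj (zc X)) (1 / 2) (- \<i> / 2) 0 X"
  by (cases X) (auto simp: has_partials_def zc_def intro!: derivative_eq_intros)

lemma has_partials_tc: "has_partials (tc a b) 0 0 (complex_of_real b) X"
  by (cases X) (auto simp: has_partials_def tc_def intro!: derivative_eq_intros)

lemma continuous_on_zc [continuous_intros]: "continuous_on S zc"
  unfolding zc_def split_beta by (intro continuous_intros) auto

lemma continuous_on_tc [continuous_intros]: "continuous_on S (tc a b)"
  unfolding tc_def split_beta by (intro continuous_intros)

lemma Ck_on_coordinates:
  assumes "open \<Omega>"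
  shows "Ck_on k \<Omega> zc" "Ck_on k \<Omega> (\<lambda>X. cnj (zc X))" "Ck_on k \<Omega> (tc a b)"
proof -
  show "Ck_on k \<Omega> zc"
    by (cases k) (auto intro!: continuous_intros assms Ck_on_const
        Ck_on_SucI[OF _ _ has_partials_zc] simp del: Ck_on.simps(2))
  show "Ck_on k \<Omega> (\<lambda>X. cnj (zc X))"
    by (cases k) (auto intro!: continuous_intros assms Ck_on_const
        Ck_on_SucI[OF _ _ has_partials_cnj_zc] simp del: Ck_on.simps(2))
  show "Ck_on k \<Omega> (tc a b)"
    by (cases k) (auto intro!: continuous_intros assms Ck_on_const
        Ck_on_SucI[OF _ _ has_partials_tc] simp del: Ck_on.simps(2))
qed

text \<open>A common form for the data: with \<open>k\<close> equal to \<alpha> and \<open>m\<close>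
  the conjugate of \<open>zc\<close>, the choices \<open>c = \<i> * b / 2\<close> and
  \<open>c = - \<i> * b / 2\<close> give \<open>q\<close> and \<open>r\<close>; \<open>u\<close> is
  a product of two profiles with \<open>c = 0\<close>.\<close>

definition wave :: "real \<Rightarrow> real \<Rightarrow> complex \<Rightarrow> complex \<Rightarrow> (point \<Rightarrow> complex) \<Rightarrow> point \<Rightarrow> complex" where
  "wave a b c k m X =
     exp (c * (zc X * cnj (zc X) * inverse (tc a b X))) * (inverse (tc a b X) * (k * m X))"

text \<open>The product rule, with \<open>z * w\<close> having derivatives
  \<open>(w + z) / 2\<close> and \<open>\<i> * (w - z) / 2\<close> in the plane, and
  \<open>S\<close> having time derivative \<open>- b * S * S\<close>.\<close>

lemma has_partials_wave:
  fixes c :: complex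
  assumes m: "has_partials m m1 m2 0 X" and nz: "tc a b X \<noteq> 0"
  defines "E \<equiv> exp (c * (zc X * cnj (zc X) * inverse (tc a b X)))" and "S \<equiv> inverse (tc a b X)"
    and "z \<equiv> zc X" and "w \<equiv> cnj (zc X)"
  shows "has_partials (wave a b c k m)
    (E * S * k * (c * S * m X * (w + z) / 2 + m1))
    (E * S * k * (\<i> * c * S * m X * (w - z) / 2 + m2))
    (- (b * E * S * S * k * m X * (1 + c * z * w * S))) X"
  unfolding wave_def
  by (rule has_partials_eq[OF has_partials_mult[OF has_partials_exp has_partials_mult]])
    (rule has_partials_mult has_partials_const has_partials_inverse has_partials_tc
      has_partials_zc has_partials_cnj_zc m nz
    | simp add: E_def S_def z_def w_def algebra_simps add_divide_distrib diff_divide_distrib)+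

lemma Ck_on_wave:
  assumes "open \<Omega>" "Ck_on k \<Omega> m" "\<And>X. X \<in> \<Omega> \<Longrightarrow> tc a b X \<noteq> 0"
  shows "Ck_on k \<Omega> (wave a b c d m)"
  unfolding wave_def
  by (intro Ck_on_mult Ck_on_exp Ck_on_const Ck_on_inverse Ck_on_coordinates assms)

context
  fixes a b :: real and \<Omega> :: "point set" and c k :: complex
  assumes open_\<Omega>: "open \<Omega>" and nz: "\<And>X. X \<in> \<Omega> \<Longrightarrow> tc a b X \<noteq> 0"
begin

text \<open>The derivatives of \<open>q\<close> and \<open>r\<close> at once, for general
  \<open>c\<close>, in terms of \<open>E\<close>, \<open>S\<close>, \<open>z\<close> and
  \<open>w\<close>.\<close>

lemma wave_cnj_zc_derivs:
  fixes S z w E :: complex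
  assumes f: "\<And>X. X \<in> \<Omega> \<Longrightarrow> f X = wave a b c k (\<lambda>X. cnj (zc X)) X" and X: "X \<in> \<Omega>"
  defines "S \<equiv> inverse (tc a b X)" and "z \<equiv> zc X" and "w \<equiv> cnj (zc X)"
  defines "E \<equiv> exp (c * (z * w * S))"
  shows "Dt f X = - (b * E * S^2 * k * w * (1 + c * z * w * S))"
    and "Dzbar f X = E * S * k * (1 + c * z * w * S)"
    and "Dzbar (Dz f) X = E * S^2 * k * w * c * (2 + c * z * w * S)"
proof -
  note W = has_partials_transform[OF has_partials_wave[OF has_partials_cnj_zc nz] open_\<Omega> _ f[symmetric]]
  note d = W[OF X X]
  show "Dt f X = - (b * E * S^2 * k * w * (1 + c * z * w * S))"
    using has_partials_D(3)[OF d]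
    by (simp add: S_def E_def z_def w_def power2_eq_square mult.assoc)
  show "Dzbar f X = E * S * k * (1 + c * z * w * S)"
    by (simp add: has_partials_Dz(2)[OF d] S_def z_def w_def E_def algebra_simps
        add_divide_distrib diff_divide_distrib)
  \<comment> \<open>\<open>Dz\<close> annihilates the conjugate of \<open>zc\<close> and
    \<open>tc\<close>, so it acts only on the exponential and multiplies \<open>f\<close> by
    \<open>c * S * w\<close>. The second derivative then needs just the product rule.\<close>
  have Dzf: "f Y * (c * (inverse (tc a b Y) * cnj (zc Y))) = Dz f Y" if "Y \<in> \<Omega>" for Y
    by (simp add: has_partials_Dz(1)[OF W[OF that that]] wave_def f that algebra_simps
        add_divide_distrib diff_divide_distrib)
  note Dzf_partials = has_partials_transform[OF has_partials_mult[OF d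
      has_partials_mult[OF has_partials_const has_partials_mult[OF
        has_partials_inverse[OF has_partials_tc nz[OF X]] has_partials_cnj_zc]]] open_\<Omega> X Dzf]
  show "Dzbar (Dz f) X = E * S^2 * k * w * c * (2 + c * z * w * S)"
    by (simp add: has_partials_Dz(2)[OF Dzf_partials] f X wave_def S_def z_def w_def E_def
        power2_eq_square algebra_simps add_divide_distrib diff_divide_distrib)
qed

end

text \<open>Since \<open>z * w * S\<close> is real, both exponentials have modulus 1. This gives |q|
  = |r| for the fourth equation.\<close>

lemma norm_wave:
  "cmod (wave a b (- (\<i> * complex_of_real c)) k m X) = cmod (wave a b (\<i> * complex_of_real c) k m X)"
proof -
  obtain \<tau> where "tc a b X = complex_of_real \<tau>"
    by (cases X) (metis case_prod_conv tc_def)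
  then have "zc X * cnj (zc X) * inverse (tc a b X) = complex_of_real ((cmod (zc X))\<^sup>2 / \<tau>)"
    by (simp add: divide_inverse flip: complex_norm_square)
  then obtain \<theta> where \<theta>: "zc X * cnj (zc X) * inverse (tc a b X) = complex_of_real \<theta>" ..
  show ?thesis
    by (simp add: wave_def \<theta> norm_mult)
qed

text \<open>\<open>tc\<close> is real, so conjugation affects only \<open>c\<close> and
  \<open>m\<close>. For the fifth equation: the conjugate of \<open>r\<close> has the exponential of
  \<open>q\<close>, with \<open>zc\<close> as its linear factor.\<close>

lemma cnj_wave:
  "cnj (wave a b c (complex_of_real k) m X) = wave a b (cnj c) (complex_of_real k) (\<lambda>X. cnj (m X)) X"
proof -
  have "cnj (tc a b X) = tc a b X" by (cases X) (simp add: tc_def)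
  then show ?thesis by (simp add: wave_def mult.commute exp_cnj)
qed

section \<open>The system evaluated on the given functions\<close>

text \<open>Two degenerate cases are excluded. If a = b = 0, the domain is empty and every \<alpha>
  gives a solution. If \<alpha> = 0 and b is nonzero, all four functions vanish on the domain and
  solve the system, although \<alpha> squared differs from b^2 / 16.\<close>

theorem lemma1:
  fixes a b \<alpha> :: real
    and p q r :: "point \<Rightarrow> complex" and u :: "point \<Rightarrow> real"
    and \<Omega> :: "point set"
  defines "\<Omega> \<equiv> {(x\<^sub>1, x\<^sub>2, t). a + b * t \<noteq> 0}"
  assumes domain_nonempty: "a \<noteq> 0 \<or> b \<noteq> 0"
    and nontrivial: "\<alpha> \<noteq> 0 \<or> b = 0"
    and p: "\<And>x\<^sub>1 x\<^sub>2 t. a + b * t \<noteq> 0 \<Longrightarrow> p (x\<^sub>1, x\<^sub>2, t) = 0"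
    and q: "\<And>x\<^sub>1 x\<^sub>2 t. a + b * t \<noteq> 0 \<Longrightarrow> q (x\<^sub>1, x\<^sub>2, t) =
        exp (\<i> * (complex_of_real b * zc (x\<^sub>1, x\<^sub>2, t) * cnj (zc (x\<^sub>1, x\<^sub>2, t))
                  / complex_of_real (2 * (a + b * t))))
          / complex_of_real (a + b * t) * complex_of_real \<alpha> * cnj (zc (x\<^sub>1, x\<^sub>2, t))"
    and r: "\<And>x\<^sub>1 x\<^sub>2 t. a + b * t \<noteq> 0 \<Longrightarrow> r (x\<^sub>1, x\<^sub>2, t) =
        exp (- \<i> * (complex_of_real b * zc (x\<^sub>1, x\<^sub>2, t) * cnj (zc (x\<^sub>1, x\<^sub>2, t))
                    / complex_of_real (2 * (a + b * t))))
          / complex_of_real (a + b * t) * complex_of_real \<alpha> * cnj (zc (x\<^sub>1, x\<^sub>2, t))"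
    and u: "\<And>x\<^sub>1 x\<^sub>2 t. a + b * t \<noteq> 0 \<Longrightarrow> complex_of_real (u (x\<^sub>1, x\<^sub>2, t)) =
        2 * complex_of_real (\<alpha>\<^sup>2) * zc (x\<^sub>1, x\<^sub>2, t) * cnj (zc (x\<^sub>1, x\<^sub>2, t))
          / complex_of_real ((a + b * t)\<^sup>2)"
  shows "is_solution \<Omega> p q r u \<longleftrightarrow> \<alpha>\<^sup>2 = b\<^sup>2 / 16"
proof -
  let ?k = "complex_of_real \<alpha>" and ?c = "\<i> * complex_of_real (b / 2)"
  let ?w = "\<lambda>X. cnj (zc X)"
  have "\<Omega> = {X. a + b * snd (snd X) \<noteq> 0}"
    by (auto simp: \<Omega>_def)
  moreover have "open {X :: point. a + b * snd (snd X) \<noteq> 0}"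
    by (intro open_Collect_neq continuous_intros)
  ultimately have op: "open \<Omega>" by simp
  have nz: "tc a b X \<noteq> 0" if "X \<in> \<Omega>" for X
    using that by (auto simp: \<Omega>_def tc_def simp flip: of_real_mult of_real_add)
  have p': "p X = 0" if "X \<in> \<Omega>" for X
  proof -
    obtain x y t where X: "X = (x, y, t)" by (cases X)
    with that have "a + b * t \<noteq> 0" by (simp add: \<Omega>_def)
    from p[OF this, of x y] show ?thesis
      by (simp add: X)
  qed
  have q': "q X = wave a b ?c ?k ?w X" if "X \<in> \<Omega>" for X
  proof -
    obtain x y t where X: "X = (x, y, t)" by (cases X)
    \<comment> \<open>Folding the sum into \<open>T\<close> keeps \<open>of_real\<close> from being
      distributed over it.\<close>
    define T where "T = a + b * t"
    have "a + b * t \<noteq> 0" using that X by (simp add: \<Omega>_def)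
    from q[OF this, of x y] show ?thesis
      unfolding X wave_def tc_def prod.case divide_inverse
      by (simp add: mult_ac flip: T_def)
  qed
  have r': "r X = wave a b (- ?c) ?k ?w X" if "X \<in> \<Omega>" for X
  proof -
    obtain x y t where X: "X = (x, y, t)" by (cases X)
    define T where "T = a + b * t"
    have "a + b * t \<noteq> 0" using that X by (simp add: \<Omega>_def)
    from r[OF this, of x y] show ?thesis
      unfolding X wave_def tc_def prod.case divide_inverse
      by (simp add: mult_ac flip: T_def)
  qed
  \<comment> \<open>With \<open>c = 0\<close> the exponential is 1, and u factors as (\<alpha> w /
    T) (2 \<alpha> z / T), where w is the conjugate of z.\<close>
  have u': "complex_of_real (u X) = wave a b 0 ?k ?w X * wave a b 0 (2 * ?k) zc X" if "X \<in> \<Omega>" for X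
  proof -
    obtain x y t where X: "X = (x, y, t)" by (cases X)
    define T where "T = a + b * t"
    have "a + b * t \<noteq> 0" using that X by (simp add: \<Omega>_def)
    from u[OF this, of x y] show ?thesis
      unfolding X wave_def tc_def prod.case divide_inverse
      by (simp add: power2_eq_square mult_ac flip: T_def)
  qed
  have Ck: "Ck_on 2 \<Omega> p" "Ck_on 2 \<Omega> q" "Ck_on 2 \<Omega> r" "Ck_on 2 \<Omega> (\<lambda>X. complex_of_real (u X))"
  proof -
    note wave = Ck_on_wave[OF op _ nz] and coords = Ck_on_coordinates[OF op]
    show "Ck_on 2 \<Omega> p" by (rule Ck_on_cong[OF op Ck_on_const[OF op] p'[symmetric]])
    show "Ck_on 2 \<Omega> q" by (rule Ck_on_cong[OF op wave[OF coords(2)] q'[symmetric]])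
    show "Ck_on 2 \<Omega> r" by (rule Ck_on_cong[OF op wave[OF coords(2)] r'[symmetric]])
    show "Ck_on 2 \<Omega> (\<lambda>X. complex_of_real (u X))"
      by (rule Ck_on_cong[OF op Ck_on_mult[OF op wave[OF coords(2)] wave[OF coords(1)]] u'[symmetric]])
  qed
  define defect where "defect X = exp (?c * (zc X * ?w X * inverse (tc a b X))) * ?k * zc X
    * (?w X)^2 * inverse (tc a b X)^3 * (b^2 / 4 - 4 * \<alpha>^2)" for X
  define defect' where "defect' X = exp (- ?c * (zc X * ?w X * inverse (tc a b X))) * ?k * zc X
    * (?w X)^2 * inverse (tc a b X)^3 * (4 * \<alpha>^2 - b^2 / 4)" for X
  note zero = has_partials_const[of 0]
  \<comment> \<open>\<open>p\<close> is known only on \<open>\<Omega>\<close>; being locally zero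
    there, it also makes its products with an arbitrary \<open>f\<close> locally zero.\<close>
  have Dp: "Dt p X = 0" "Dzbar p X = 0" "Dz (\<lambda>Y. cnj (p Y)) X = 0"
      "Dz (\<lambda>Y. cnj (p Y) * f Y) X = 0" if "X \<in> \<Omega>" for X f
  proof -
    have P: "has_partials p 0 0 0 X"
      using p' by (intro has_partials_transform[OF zero op that]) simp
    show "Dt p X = 0" "Dzbar p X = 0"
      using has_partials_D(3)[OF P] has_partials_Dz(2)[OF P] by simp_all
    have "has_partials (\<lambda>Y. cnj (p Y)) 0 0 0 X" "has_partials (\<lambda>Y. cnj (p Y) * f Y) 0 0 0 X"
      using p' by (intro has_partials_transform[OF zero op that]; simp)+
    from this[THEN has_partials_Dz(1)]
    show "Dz (\<lambda>Y. cnj (p Y)) X = 0" "Dz (\<lambda>Y. cnj (p Y) * f Y) X = 0" by simp_all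
  qed
  \<comment> \<open>Since \<open>- \<i> * b = - 2 * ?c\<close>, the terms of order
    \<open>S^2\<close> cancel. What remains is \<open>- ?c^2 = b^2 / 4\<close>, against
    \<open>4 * \<alpha>^2\<close> from \<open>2 * u * q\<close>.\<close>
  have eq1: "\<i> * Dt q X + Dzbar (Dz q) X - 2 * complex_of_real (u X) * q X = defect X"
    if X: "X \<in> \<Omega>" for X
    by (simp add: wave_cnj_zc_derivs[OF op nz q' X] q'[OF X] u'[OF X] defect_def wave_def
        power2_eq_square power3_eq_cube algebra_simps add_divide_distrib diff_divide_distrib)
  have eq2: "\<i> * Dt r X - Dzbar (Dz r) X + 2 * complex_of_real (u X) * r X = defect' X"
    if X: "X \<in> \<Omega>" for X
    by (simp add: wave_cnj_zc_derivs[OF op nz r' X] r'[OF X] u'[OF X] defect'_def wave_def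
        power2_eq_square power3_eq_cube algebra_simps add_divide_distrib diff_divide_distrib)
  have eq3: "Dzbar (\<lambda>Y. q Y * r Y) X = Dz (\<lambda>Y. complex_of_real (u Y)) X" if X: "X \<in> \<Omega>" for X
  proof -
    note W = has_partials_wave[OF has_partials_cnj_zc nz[OF X], where c = 0]
      and Z = has_partials_wave[OF has_partials_zc nz[OF X], where c = 0]
    \<comment> \<open>The exponentials of \<open>q\<close> and \<open>r\<close> are mutually
      inverse. Hence both sides of the third equation become 2 \<alpha>^2 w / T^2.\<close>
    have qr: "wave a b 0 ?k ?w Y * wave a b 0 ?k ?w Y = q Y * r Y" if "Y \<in> \<Omega>" for Y
      using q'[OF that] r'[OF that] by (simp add: wave_def exp_minus)
    note QR = has_partials_transform[OF has_partials_mult[OF W W] op X qr]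
      and U = has_partials_transform[OF has_partials_mult[OF W Z] op X u'[symmetric]]
    show ?thesis
      by (simp add: has_partials_Dz(2)[OF QR] has_partials_Dz(1)[OF U] wave_def algebra_simps
          add_divide_distrib diff_divide_distrib)
  qed
  have eq4: "cmod (r X) = cmod (q X)" if "X \<in> \<Omega>" for X
    using q'[OF that] r'[OF that] norm_wave[of a b "b / 2"] by simp
  have eq5: "Dz (\<lambda>Y. cnj (r Y)) X = Dzbar q X" if X: "X \<in> \<Omega>" for X
  proof -
    have R: "wave a b ?c ?k zc Y = cnj (r Y)" if "Y \<in> \<Omega>" for Y
      using r'[OF that] cnj_wave[of a b "- ?c" \<alpha> ?w Y] by simp
    note R = has_partials_transform[OF has_partials_wave[OF has_partials_zc nz[OF X]] op X R]
    \<comment> \<open>Both sides equal \<open>E * S * k * (1 + c * z * w * S)\<close>, which is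
      symmetric in \<open>z\<close> and \<open>w\<close>.\<close>
    show ?thesis
      by (simp add: wave_cnj_zc_derivs[OF op nz q' X] has_partials_Dz(1)[OF R] algebra_simps
          add_divide_distrib diff_divide_distrib)
  qed
  have "is_solution \<Omega> p q r u \<longleftrightarrow> (\<forall>X\<in>\<Omega>. defect X = 0 \<and> defect' X = 0)"
    unfolding is_solution_def
    \<comment> \<open>\<open>ball_cong\<close> supplies \<open>X \<in> \<Omega>\<close>, the
      condition under which the pointwise equations rewrite.\<close>
    by (simp add: Ck Dp p' eq1 eq2 eq3 eq4 eq5 cong: ball_cong)
  also have "\<dots> \<longleftrightarrow> \<alpha>\<^sup>2 = b\<^sup>2 / 16"
  proof
    assume *: "\<forall>X\<in>\<Omega>. defect X = 0 \<and> defect' X = 0"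
    \<comment> \<open>t = 0 serves if a is nonzero, t = 1 if a = 0.\<close>
    obtain t where "a + b * t \<noteq> 0"
      using domain_nonempty
      by (metis add.right_neutral add_cancel_right_left mult.right_neutral mult_zero_right)
    \<comment> \<open>Because of the factor 1/2 in \<open>zc\<close>, this point has z = 1, so only
      \<alpha> and the last factor of the defect can vanish.\<close>
    then have X: "(2, 0, t) \<in> \<Omega>" by (simp add: \<Omega>_def)
    with * have "defect (2, 0, t) = 0" by blast
    moreover have "zc (2, 0, t) = 1" by (simp add: zc_def)
    ultimately have "\<alpha> = 0 \<or> complex_of_real (b^2 / 4 - 4 * \<alpha>^2) = 0"
      using nz[OF X] by (simp add: defect_def)
    \<comment> \<open>In the case \<alpha> = 0, \<open>nontrivial\<close> forces b = 0 and the claim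
      reads 0 = 0.\<close>
    then show "\<alpha>\<^sup>2 = b\<^sup>2 / 16"
      using nontrivial unfolding of_real_eq_0_iff by auto
  next
    assume "\<alpha>\<^sup>2 = b\<^sup>2 / 16"
    then have "b^2 = 16 * \<alpha>^2" by simp
    then show "\<forall>X\<in>\<Omega>. defect X = 0 \<and> defect' X = 0"
      by (simp add: defect_def defect'_def flip: of_real_power)
  qed
  finally show ?thesis .
qed

end
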